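(* Let $P$ be a partially ordered set, let $i\in\{1,2,3\}$ and let $(x_\alpha)_{\alpha\in A}$ and $(y_\beta)_{\beta\in B}$ be nets in $P$ such that $x_\alpha\xrightarrow{o_i}x\in P$ and $y_\beta\xrightarrow{o_i}y\in P$. If for every $\alpha_0\in A$ and $\beta_0\in B$ there are $\alpha\in A_{\ge\alpha_0}$ and $\beta\in B_{\ge\beta_0}$ such that $x_\alpha\le y_\beta$, then $x\le y$.
   Context: Nets are indexed by non-empty upward directed partially ordered sets. For a net in a partially ordered set $P$, $x_\alpha\downarrow x$ means that $x_\alpha\le x_\beta$ whenever $\alpha\ge\beta$ and $\inf_\alpha x_\alpha=x$; $x_\alpha\uparrow x$ is defined dually. $A_{\ge\alpha_0}:=\{\alpha\in A;\ \alpha\ge\alpha_0\}$. Order convergence in $P$, for a net $(x_\alpha)_{\alpha\in A}$ in $P$ and $x\in P$: - $x_\alpha\xrightarrow{o_1}x$ if there are nets $(\hat x_\alpha)_{\alpha\in A}$, $(\check x_\alpha)_{\alpha\in A}$ in $P$ with $\hat x_\alpha\uparrow x$, $\check x_\alpha\downarrow x$ and $\hat x_\alpha\le x_\alpha\le\check x_\alpha$ for all $\alpha\in A$. - $x_\alpha\xrightarrow{o_2}x$ if there are such nets $(\hat x_\alpha)_{\alpha\in A}$, $(\check x_\alpha)_{\alpha\in A}$ with $\hat x_\alpha\uparrow x$, $\check x_\alpha\downarrow x$, and $\alpha_0\in A$ with $\hat x_\alpha\le x_\alpha\le\check x_\alpha$ for all $\alpha\in A_{\ge\alpha_0}$. -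 $x_\alpha\xrightarrow{o_3}x$ if there are nets $(\hat x_\beta)_{\beta\in B}$, $(\check x_\gamma)_{\gamma\in C}$ in $P$ and a map $\eta\colon B\times C\to A$ with $\hat x_\beta\uparrow x$, $\check x_\gamma\downarrow x$ and $\hat x_\beta\le x_\alpha\le\check x_\gamma$ for all $\beta\in B$, $\gamma\in C$, $\alpha\in A_{\ge\eta(\beta,\gamma)}$. *)

theory Defs
  imports "HOL-Library.Lub_Glb" "HOL-Library.FuncSet"
begin

text \<open>
  The partially ordered set \<open>P\<close> is a type \<open>'p\<close> of class \<open>order\<close>. An index set is a carrier \<open>A\<close>
  together with a relation \<open>r\<close>, where \<open>(a, b) \<in> r\<close> means \<open>a \<le> b\<close>. A net \<open>(x\<^sub>a)\<close> in \<open>P\<close> is a function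
  \<open>x\<close> of which only the values on \<open>A\<close> matter.
\<close>

definition directed_poset :: "'a set \<Rightarrow> 'a rel \<Rightarrow> bool" where
  "directed_poset A r \<longleftrightarrow>
     A \<noteq> {} \<and> partial_order_on A r \<and> (\<forall>a\<in>A. \<forall>b\<in>A. \<exists>c\<in>A. (a, c) \<in> r \<and> (b, c) \<in> r)"

definition tail :: "'a set \<Rightarrow> 'a rel \<Rightarrow> 'a \<Rightarrow> 'a set" where
  "tail A r a0 = {a\<in>A. (a0, a) \<in> r}"

definition net_down :: "'a set \<Rightarrow> 'a rel \<Rightarrow> ('a \<Rightarrow> 'p::order) \<Rightarrow> 'p \<Rightarrow> bool" where
  "net_down A r x l \<longleftrightarrow>
     (\<forall>a\<in>A. \<forall>b\<in>A. (b, a) \<in> r \<longrightarrow> x a \<le> x b) \<and> isGlb UNIV (x ` A) l"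

definition net_up :: "'a set \<Rightarrow> 'a rel \<Rightarrow> ('a \<Rightarrow> 'p::order) \<Rightarrow> 'p \<Rightarrow> bool" where
  "net_up A r x l \<longleftrightarrow>
     (\<forall>a\<in>A. \<forall>b\<in>A. (b, a) \<in> r \<longrightarrow> x b \<le> x a) \<and> isLub UNIV (x ` A) l"

definition o1_conv :: "'a set \<Rightarrow> 'a rel \<Rightarrow> ('a \<Rightarrow> 'p::order) \<Rightarrow> 'p \<Rightarrow> bool" where
  "o1_conv A r x l \<longleftrightarrow>
     (\<exists>lo up. net_up A r lo l \<and> net_down A r up l \<and> (\<forall>a\<in>A. lo a \<le> x a \<and> x a \<le> up a))"

definition o2_conv :: "'a set \<Rightarrow> 'a rel \<Rightarrow> ('a \<Rightarrow> 'p::order) \<Rightarrow> 'p \<Rightarrow> bool" where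
  "o2_conv A r x l \<longleftrightarrow>
     (\<exists>lo up. net_up A r lo l \<and> net_down A r up l \<and>
        (\<exists>a0\<in>A. \<forall>a\<in>tail A r a0. lo a \<le> x a \<and> x a \<le> up a))"

text \<open>
  The definition of \<open>o\<^sub>3\<close>-convergence asks for two nets over arbitrary directed index sets. HOL has
  no quantification over types inside a formula, so the types \<open>'b\<close> and \<open>'c\<close> from which these index
  sets are taken are parameters. A theorem with \<open>o3_conv TYPE('b) TYPE('c)\<close> as a hypothesis, and
  with \<open>'b\<close> and \<open>'c\<close> occurring in no other way, holds for index sets in every choice of types.
\<close>

definition o3_conv ::
  "'b itself \<Rightarrow> 'c itself \<Rightarrow> 'a set \<Rightarrow> 'a rel \<Rightarrow> ('a \<Rightarrow> 'p::order) \<Rightarrow> 'p \<Rightarrow> bool" where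
  "o3_conv _ _ A r x l \<longleftrightarrow>
     (\<exists>(B :: 'b set) rB (C :: 'c set) rC lo up \<eta>.
        directed_poset B rB \<and> directed_poset C rC \<and> \<eta> \<in> B \<times> C \<rightarrow> A \<and>
        net_up B rB lo l \<and> net_down C rC up l \<and>
        (\<forall>b\<in>B. \<forall>c\<in>C. \<forall>a\<in>tail A r (\<eta> (b, c)). lo b \<le> x a \<and> x a \<le> up c))"

text \<open>The type parameters are only relevant for \<open>i = 3\<close>.\<close>

definition order_conv ::
  "'b itself \<Rightarrow> 'c itself \<Rightarrow> nat \<Rightarrow> 'a set \<Rightarrow> 'a rel \<Rightarrow> ('a \<Rightarrow> 'p::order) \<Rightarrow> 'p \<Rightarrow> bool" where
  "order_conv tb tc i A r x l \<longleftrightarrow>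
     i = 1 \<and> o1_conv A r x l \<or> i = 2 \<and> o2_conv A r x l \<or> i = 3 \<and> o3_conv tb tc A r x l"

end

theory Submission
  imports Defs
begin

text \<open>Bounds valid at every index hold on each tail, and non-emptiness of \<open>A\<close>
  supplies a threshold. This absorbs the case \<open>i = 1\<close> into
  \<open>i = 2\<close>.\<close>

lemma o1_conv_imp_o2_conv:
  assumes "directed_poset A r" "o1_conv A r x l"
  shows "o2_conv A r x l"
proof -
  obtain a0 where "a0 \<in> A"
    using assms(1) unfolding directed_poset_def by blast
  moreover obtain lo up where "net_up A r lo l" "net_down A r up l"
    "\<forall>a\<in>A. lo a \<le> x a \<and> x a \<le> up a"
    using assms(2) unfolding o1_conv_def by blast
  moreover from this(3) have "\<forall>a\<in>tail A r a0. lo a \<le> x a \<and> x a \<le> up a"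
    by (simp add: tail_def)
  ultimately show ?thesis
    unfolding o2_conv_def by blast
qed

text \<open>Directedness gives \<open>c\<close> above \<open>a\<close> and \<open>b\<close>; by
  transitivity whatever lies beyond \<open>c\<close> lies beyond both. Two conditions that hold
  eventually can thus be given a common threshold.\<close>

lemma directed_poset_tail_subset:
  assumes "directed_poset A r" "a \<in> A" "b \<in> A"
  obtains c where "c \<in> A" "tail A r c \<subseteq> tail A r a \<inter> tail A r b"
proof -
  obtain c where c: "c \<in> A" "(a, c) \<in> r" "(b, c) \<in> r"
    using assms unfolding directed_poset_def by blast
  have "trans r"
    using assms(1) by (simp add: directed_poset_def partial_order_on_def preorder_on_def)
  then have "tail A r c \<subseteq> tail A r a \<inter> tail A r b"
    using c by (auto simp: tail_def dest: transD)
  with c show thesis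
    using that by blast
qed

text \<open>
  The bounding nets enter only through their ranges: the lower one is replaced by a set \<open>L\<close> of
  eventual lower bounds with supremum \<open>l\<close>, the upper one by a set \<open>U\<close> of eventual upper bounds
  with infimum \<open>l\<close>. This form is common to all three notions of convergence.
\<close>

lemma order_conv_eventual_bounds:
  fixes tb :: "'b itself" and tc :: "'c itself"
  assumes dir: "directed_poset A r" and conv: "order_conv tb tc i A r x l"
  obtains L U where "isLub UNIV L l" "isGlb UNIV U l"
    "\<forall>p\<in>L. \<exists>a0\<in>A. \<forall>a\<in>tail A r a0. p \<le> x a"
    "\<forall>q\<in>U. \<exists>a0\<in>A. \<forall>a\<in>tail A r a0. x a \<le> q"
proof -
  consider "o2_conv A r x l" | "o3_conv tb tc A r x l"
    using conv o1_conv_imp_o2_conv[OF dir] unfolding order_conv_def by blast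
  then show thesis
  proof cases
    case 1
    then obtain lo up a0 where lo: "net_up A r lo l" and up: "net_down A r up l"
      and a0: "a0 \<in> A" "\<forall>a\<in>tail A r a0. lo a \<le> x a \<and> x a \<le> up a"
      unfolding o2_conv_def by blast
    \<comment> \<open>The index \<open>b\<close> need not lie beyond \<open>a0\<close>, so
      \<open>lo b\<close> and \<open>up b\<close> may fail to bound \<open>x b\<close>. Beyond a
      common successor of \<open>a0\<close> and \<open>b\<close>, monotonicity gives
      \<open>lo b\<close> \<le> \<open>lo a\<close> \<le> \<open>x a\<close> \<le>
      \<open>up a\<close> \<le> \<open>up b\<close>.\<close>
    have bounds: "\<exists>c\<in>A. \<forall>a\<in>tail A r c. lo b \<le> x a \<and> x a \<le> up b" if b: "b \<in> A" for b
    proof -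
      obtain c where c: "c \<in> A" "tail A r c \<subseteq> tail A r a0 \<inter> tail A r b"
        using directed_poset_tail_subset[OF dir a0(1) b] .
      have "lo b \<le> x a \<and> x a \<le> up b" if "a \<in> tail A r c" for a
      proof -
        have "a \<in> tail A r a0" "a \<in> A" "(b, a) \<in> r"
          using that c(2) by (auto simp: tail_def)
        then have "lo b \<le> lo a" "up a \<le> up b" "lo a \<le> x a" "x a \<le> up a"
          using lo up a0(2) b by (auto simp: net_up_def net_down_def)
        then show ?thesis
          by (meson order_trans)
      qed
      with c(1) show ?thesis
        by blast
    qed
    show thesis
    proof (rule that[of "lo ` A" "up ` A"])
      show "isLub UNIV (lo ` A) l" "isGlb UNIV (up ` A) l"
        using lo up by (simp_all add: net_up_def net_down_def)
      show "\<forall>p\<in>lo ` A. \<exists>a0\<in>A. \<forall>a\<in>tail A r a0. p \<le> x a"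
        using bounds by (metis imageE)
      show "\<forall>q\<in>up ` A. \<exists>a0\<in>A. \<forall>a\<in>tail A r a0. x a \<le> q"
        using bounds by (metis imageE)
    qed
  next
    case 2
    then obtain B :: "'b set" and rB and C :: "'c set" and rC lo up \<eta>
      where "directed_poset B rB" "directed_poset C rC"
      and \<eta>: "\<eta> \<in> B \<times> C \<rightarrow> A" and lo: "net_up B rB lo l" and up: "net_down C rC up l"
      and bounds: "\<forall>b\<in>B. \<forall>c\<in>C. \<forall>a\<in>tail A r (\<eta> (b, c)). lo b \<le> x a \<and> x a \<le> up c"
      unfolding o3_conv_def by blast
    \<comment> \<open>The map \<open>\<eta>\<close> takes a pair, whereas a one-sided bound involves
      only one index; \<open>b0\<close> and \<open>c0\<close> are arbitrary fillers for the other
      coordinate.\<close>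
    from \<open>directed_poset B rB\<close> \<open>directed_poset C rC\<close> obtain b0 c0 where "b0 \<in> B" "c0 \<in> C"
      unfolding directed_poset_def by blast
    show thesis
    proof (rule that[of "lo ` B" "up ` C"])
      show "isLub UNIV (lo ` B) l" "isGlb UNIV (up ` C) l"
        using lo up by (simp_all add: net_up_def net_down_def)
      have "\<exists>a0\<in>A. \<forall>a\<in>tail A r a0. lo b \<le> x a" if "b \<in> B" for b
      proof (rule bexI[of _ "\<eta> (b, c0)"])
        show "\<forall>a\<in>tail A r (\<eta> (b, c0)). lo b \<le> x a"
          using bounds that \<open>c0 \<in> C\<close> by simp
        show "\<eta> (b, c0) \<in> A"
          using \<eta> that \<open>c0 \<in> C\<close> by auto
      qed
      then show "\<forall>p\<in>lo ` B. \<exists>a0\<in>A. \<forall>a\<in>tail A r a0. p \<le> x a"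
        by simp
      have "\<exists>a0\<in>A. \<forall>a\<in>tail A r a0. x a \<le> up c" if "c \<in> C" for c
      proof (rule bexI[of _ "\<eta> (b0, c)"])
        show "\<forall>a\<in>tail A r (\<eta> (b0, c)). x a \<le> up c"
          using bounds that \<open>b0 \<in> B\<close> by simp
        show "\<eta> (b0, c) \<in> A"
          using \<eta> that \<open>b0 \<in> B\<close> by auto
      qed
      then show "\<forall>q\<in>up ` C. \<exists>a0\<in>A. \<forall>a\<in>tail A r a0. x a \<le> q"
        by simp
    qed
  qed
qed

theorem proposition3p16:
  fixes A :: "'a set" and rA :: "'a rel" and x :: "'a \<Rightarrow> 'p::order"
    and B :: "'b set" and rB :: "'b rel" and y :: "'b \<Rightarrow> 'p"
    and lx ly :: 'p and i :: nat
  assumes "i \<in> {1, 2, 3}"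
    and "directed_poset A rA" and "directed_poset B rB"
    and "order_conv TYPE('c) TYPE('d) i A rA x lx"
    and "order_conv TYPE('e) TYPE('f) i B rB y ly"
    and "\<forall>a0\<in>A. \<forall>b0\<in>B. \<exists>a\<in>tail A rA a0. \<exists>b\<in>tail B rB b0. x a \<le> y b"
  shows "lx \<le> ly"
proof -
  obtain L where L: "isLub UNIV L lx" "\<forall>p\<in>L. \<exists>a0\<in>A. \<forall>a\<in>tail A rA a0. p \<le> x a"
    by (rule order_conv_eventual_bounds[OF assms(2,4)])
  obtain U where U: "isGlb UNIV U ly" "\<forall>q\<in>U. \<exists>b0\<in>B. \<forall>b\<in>tail B rB b0. y b \<le> q"
    by (rule order_conv_eventual_bounds[OF assms(3,5)])
  \<comment> \<open>The cofinality hypothesis, applied at the thresholds of \<open>p\<close> and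
    \<open>q\<close>, yields \<open>a\<close> and \<open>b\<close> with \<open>p\<close> \<le>
    \<open>x a\<close> \<le> \<open>y b\<close> \<le> \<open>q\<close>.\<close>
  have "p \<le> q" if "p \<in> L" "q \<in> U" for p q
  proof -
    obtain a0 where a0: "a0 \<in> A" "\<forall>a\<in>tail A rA a0. p \<le> x a"
      using L(2) \<open>p \<in> L\<close> by metis
    obtain b0 where b0: "b0 \<in> B" "\<forall>b\<in>tail B rB b0. y b \<le> q"
      using U(2) \<open>q \<in> U\<close> by metis
    obtain a b where "a \<in> tail A rA a0" "b \<in> tail B rB b0" "x a \<le> y b"
      using assms(6) a0(1) b0(1) by metis
    with a0(2) b0(2) have "p \<le> x a" "x a \<le> y b" "y b \<le> q"
      by simp_all
    then show ?thesis
      by (meson order_trans)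
  qed
  \<comment> \<open>Passage to the limits, one side at a time: each \<open>p\<close> in
    \<open>L\<close> is a lower bound of \<open>U\<close>, hence below its infimum
    \<open>ly\<close>; so \<open>ly\<close> is an upper bound of \<open>L\<close>, hence above its
    supremum \<open>lx\<close>.\<close>
  then have "p \<le> ly" if "p \<in> L" for p
    using that by (intro isGlb_le_isLb[OF U(1)]) (auto intro!: isLbI setgeI)
  then show ?thesis
    by (intro isLub_le_isUb[OF L(1)]) (auto intro!: isUbI setleI)
qed

end
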